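(* If $\mathcal{B}$ is a locally ordered Cartesian bicategory, then its Karoubi bicategory $\mathbf{Kar}(\mathcal{B})$ is a locally ordered Cartesian bicategory too.
   Context: A locally ordered bicategory is a bicategory in which every hom-category is a partially ordered set (antisymmetric), with 2-cells written $\le$; it is in particular a 2-category. A tensor product on $\mathcal B$ is a pseudofunctor $\otimes:\mathcal B\times\mathcal B\to\mathcal B$ with an object $I$ and natural isomorphisms $\rho:X\to X\otimes I$, $\lambda:X\to I\otimes X$, $\gamma:X\otimes Y\to Y\otimes X$, $\alpha:(X\otimes Y)\otimes Z\to X\otimes(Y\otimes Z)$ satisfying the usual coherence conditions of a symmetric monoidal structure (pentagon, unit triangle, hexagon, $\gamma\gamma=1$). $\mathcal B$ is Cartesian (has a Cartesian structure) if it has a tensor product and every object $X$ has a cocommutative comonoid structure $d_X:X\to X\otimes X$, $t_X:X\to I$ (i.e. $(X\otimes d_X)d_X=\alpha(d_X\otimes X)d_X$, $(X\otimes t_X)d_X=\rho$, $(t_X\otimes X)d_X=\lambda$, $\gamma d_X=d_X$) such that: (1) for each arrow $F:X\to Y$, $d_YF\le(F\otimes F)d_X$ and $t_YF\le t_X$; (2) $d_X$ and $t_X$ have right adjoints $d_X^*$, $t_X^*$. The Karoubi bicategory $\mathbf{Kar}(\mathcal B)$: objects are pairs $(A,a)$ with $a:A\to A$ in $\mathcal B$ and $aa=a$; arrows $(X,x)\to(A,a)$ are arrows $R:X\to A$ of $\mathcal B$ with $aRx=R$; 2-cells are the inequalities of $\mathcal B$; composition is that of $\mathcal B$; the identity on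 $(X,x)$ is $x$. *)

theory Defs
  imports Main
begin

text \<open>
  Bicategories with set-like carriers. \<^term>\<open>Le B F G\<close> says that there is a 2-cell from \<^term>\<open>F\<close>
  to \<^term>\<open>G\<close>; it is only meaningful for parallel arrows. Composition is in applicative order.
\<close>

record ('o, 'm) bicat =
  Obj :: "'o set"
  Arr :: "'m set"
  Dom :: "'m \<Rightarrow> 'o"
  Cod :: "'m \<Rightarrow> 'o"
  Ident :: "'o \<Rightarrow> 'm" (\<open>\<one>\<index>\<close>)
  Comp :: "'m \<Rightarrow> 'm \<Rightarrow> 'm" (infixr \<open>\<cdot>\<index>\<close> 70)
  Le :: "'m \<Rightarrow> 'm \<Rightarrow> bool" (infix \<open>\<preceq>\<index>\<close> 50)

definition hom :: "('o, 'm) bicat \<Rightarrow> 'o \<Rightarrow> 'o \<Rightarrow> 'm set" where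
  "hom B X Y = {F \<in> Arr B. Dom B F = X \<and> Cod B F = Y}"

text \<open>
  When the hom-categories are posets, an invertible 2-cell is an equality and any two parallel
  2-cells agree. So the unit and associativity constraints are identities and their coherence
  conditions hold automatically, as does the interchange law; what remains of horizontal
  composition of 2-cells is monotonicity.
\<close>

locale locally_ordered_bicategory =
  fixes B :: "('o, 'm) bicat" (structure)
  assumes dom_cod: "F \<in> Arr B \<Longrightarrow> Dom B F \<in> Obj B \<and> Cod B F \<in> Obj B"
    and ident_hom: "X \<in> Obj B \<Longrightarrow> \<one> X \<in> hom B X X"
    and comp_hom: "\<lbrakk>F \<in> hom B X Y; G \<in> hom B Y Z\<rbrakk> \<Longrightarrow> G \<cdot> F \<in> hom B X Z"
    and comp_ident_left: "F \<in> hom B X Y \<Longrightarrow> \<one> Y \<cdot> F = F"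
    and comp_ident_right: "F \<in> hom B X Y \<Longrightarrow> F \<cdot> \<one> X = F"
    and comp_assoc: "\<lbrakk>F \<in> hom B W X; G \<in> hom B X Y; H \<in> hom B Y Z\<rbrakk>
      \<Longrightarrow> (H \<cdot> G) \<cdot> F = H \<cdot> (G \<cdot> F)"
    and le_refl: "F \<in> hom B X Y \<Longrightarrow> F \<preceq> F"
    and le_trans: "\<lbrakk>F \<in> hom B X Y; G \<in> hom B X Y; H \<in> hom B X Y; F \<preceq> G; G \<preceq> H\<rbrakk> \<Longrightarrow> F \<preceq> H"
    and le_antisym: "\<lbrakk>F \<in> hom B X Y; G \<in> hom B X Y; F \<preceq> G; G \<preceq> F\<rbrakk> \<Longrightarrow> F = G"
    and comp_mono: "\<lbrakk>F \<in> hom B X Y; F' \<in> hom B X Y; G \<in> hom B Y Z; G' \<in> hom B Y Z;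
      F \<preceq> F'; G \<preceq> G'\<rbrakk> \<Longrightarrow> G \<cdot> F \<preceq> G' \<cdot> F'"

definition is_iso :: "('o, 'm) bicat \<Rightarrow> 'o \<Rightarrow> 'o \<Rightarrow> 'm \<Rightarrow> bool" where
  "is_iso B X Y F \<longleftrightarrow> F \<in> hom B X Y \<and>
    (\<exists>G \<in> hom B Y X. Comp B G F = Ident B X \<and> Comp B F G = Ident B Y)"

text \<open>The triangle identities are equations between parallel 2-cells, hence automatic.\<close>

definition has_right_adjoint :: "('o, 'm) bicat \<Rightarrow> 'o \<Rightarrow> 'o \<Rightarrow> 'm \<Rightarrow> bool" where
  "has_right_adjoint B X Y F \<longleftrightarrow> F \<in> hom B X Y \<and>
    (\<exists>G \<in> hom B Y X. Le B (Ident B X) (Comp B G F) \<and> Le B (Comp B F G) (Ident B Y))"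

text \<open>
  A pseudofunctor of two variables is given by its actions \<open>\<boxtimes>\<close> on objects and \<open>\<otimes>\<close> on arrows. As
  above, its structural 2-cells, and those of the transformations \<open>\<rho>\<close>, \<open>\<ll>\<close>, \<open>\<gamma>\<close>, \<open>\<alpha>\<close>
  (with \<open>\<ll>\<close> the left unit), are equalities. An object in an arrow position stands for its
  identity arrow in informal notation, so that \<open>X \<otimes> F\<close> reads \<open>\<one> X \<otimes> F\<close> below.
\<close>

locale tensor_product = locally_ordered_bicategory B
  for B :: "('o, 'm) bicat" (structure) +
  fixes tensor_obj :: "'o \<Rightarrow> 'o \<Rightarrow> 'o" (infixr \<open>\<boxtimes>\<close> 75)
    and tensor_arr :: "'m \<Rightarrow> 'm \<Rightarrow> 'm" (infixr \<open>\<otimes>\<close> 75)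
    and I :: 'o
    and runit :: "'o \<Rightarrow> 'm" (\<open>\<rho>\<close>)
    and lunit :: "'o \<Rightarrow> 'm" (\<open>\<ll>\<close>)
    and symm :: "'o \<Rightarrow> 'o \<Rightarrow> 'm" (\<open>\<gamma>\<close>)
    and assoc :: "'o \<Rightarrow> 'o \<Rightarrow> 'o \<Rightarrow> 'm" (\<open>\<alpha>\<close>)
  assumes tensor_obj_closed: "\<lbrakk>X \<in> Obj B; Y \<in> Obj B\<rbrakk> \<Longrightarrow> X \<boxtimes> Y \<in> Obj B"
    and tensor_arr_hom: "\<lbrakk>F \<in> hom B X X'; G \<in> hom B Y Y'\<rbrakk>
      \<Longrightarrow> F \<otimes> G \<in> hom B (X \<boxtimes> Y) (X' \<boxtimes> Y')"
    and tensor_ident: "\<lbrakk>X \<in> Obj B; Y \<in> Obj B\<rbrakk> \<Longrightarrow> \<one> X \<otimes> \<one> Y = \<one> (X \<boxtimes> Y)"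
    and tensor_comp: "\<lbrakk>F \<in> hom B X X'; F' \<in> hom B X' X''; G \<in> hom B Y Y'; G' \<in> hom B Y' Y''\<rbrakk>
      \<Longrightarrow> (F' \<cdot> F) \<otimes> (G' \<cdot> G) = (F' \<otimes> G') \<cdot> (F \<otimes> G)"
    and tensor_mono: "\<lbrakk>F \<in> hom B X X'; F' \<in> hom B X X'; G \<in> hom B Y Y'; G' \<in> hom B Y Y';
      F \<preceq> F'; G \<preceq> G'\<rbrakk> \<Longrightarrow> F \<otimes> G \<preceq> F' \<otimes> G'"
    and unit_obj: "I \<in> Obj B"
    and runit_iso: "X \<in> Obj B \<Longrightarrow> is_iso B X (X \<boxtimes> I) (\<rho> X)"
    and runit_natural: "F \<in> hom B X Y \<Longrightarrow> \<rho> Y \<cdot> F = (F \<otimes> \<one> I) \<cdot> \<rho> X"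
    and lunit_iso: "X \<in> Obj B \<Longrightarrow> is_iso B X (I \<boxtimes> X) (\<ll> X)"
    and lunit_natural: "F \<in> hom B X Y \<Longrightarrow> \<ll> Y \<cdot> F = (\<one> I \<otimes> F) \<cdot> \<ll> X"
    and symm_iso: "\<lbrakk>X \<in> Obj B; Y \<in> Obj B\<rbrakk> \<Longrightarrow> is_iso B (X \<boxtimes> Y) (Y \<boxtimes> X) (\<gamma> X Y)"
    and symm_natural: "\<lbrakk>F \<in> hom B X X'; G \<in> hom B Y Y'\<rbrakk>
      \<Longrightarrow> \<gamma> X' Y' \<cdot> (F \<otimes> G) = (G \<otimes> F) \<cdot> \<gamma> X Y"
    and assoc_iso: "\<lbrakk>X \<in> Obj B; Y \<in> Obj B; Z \<in> Obj B\<rbrakk>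
      \<Longrightarrow> is_iso B ((X \<boxtimes> Y) \<boxtimes> Z) (X \<boxtimes> (Y \<boxtimes> Z)) (\<alpha> X Y Z)"
    and assoc_natural: "\<lbrakk>F \<in> hom B X X'; G \<in> hom B Y Y'; H \<in> hom B Z Z'\<rbrakk>
      \<Longrightarrow> \<alpha> X' Y' Z' \<cdot> ((F \<otimes> G) \<otimes> H) = (F \<otimes> (G \<otimes> H)) \<cdot> \<alpha> X Y Z"
    and pentagon: "\<lbrakk>W \<in> Obj B; X \<in> Obj B; Y \<in> Obj B; Z \<in> Obj B\<rbrakk>
      \<Longrightarrow> \<alpha> W X (Y \<boxtimes> Z) \<cdot> \<alpha> (W \<boxtimes> X) Y Z
        = (\<one> W \<otimes> \<alpha> X Y Z) \<cdot> \<alpha> W (X \<boxtimes> Y) Z \<cdot> (\<alpha> W X Y \<otimes> \<one> Z)"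
    and triangle: "\<lbrakk>X \<in> Obj B; Y \<in> Obj B\<rbrakk> \<Longrightarrow> \<alpha> X I Y \<cdot> (\<rho> X \<otimes> \<one> Y) = \<one> X \<otimes> \<ll> Y"
    and hexagon: "\<lbrakk>X \<in> Obj B; Y \<in> Obj B; Z \<in> Obj B\<rbrakk>
      \<Longrightarrow> \<alpha> Y Z X \<cdot> \<gamma> X (Y \<boxtimes> Z) \<cdot> \<alpha> X Y Z
        = (\<one> Y \<otimes> \<gamma> X Z) \<cdot> \<alpha> Y X Z \<cdot> (\<gamma> X Y \<otimes> \<one> Z)"
    and symm_symm: "\<lbrakk>X \<in> Obj B; Y \<in> Obj B\<rbrakk> \<Longrightarrow> \<gamma> Y X \<cdot> \<gamma> X Y = \<one> (X \<boxtimes> Y)"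
begin

definition cocommutative_comonoid :: "'o \<Rightarrow> 'm \<Rightarrow> 'm \<Rightarrow> bool" where
  "cocommutative_comonoid X d t \<longleftrightarrow>
    d \<in> hom B X (X \<boxtimes> X) \<and> t \<in> hom B X I \<and>
    (\<one> X \<otimes> d) \<cdot> d = \<alpha> X X X \<cdot> (d \<otimes> \<one> X) \<cdot> d \<and>
    (\<one> X \<otimes> t) \<cdot> d = \<rho> X \<and>
    (t \<otimes> \<one> X) \<cdot> d = \<ll> X \<and>
    \<gamma> X X \<cdot> d = d"

end

locale cartesian_structure = tensor_product B tensor_obj tensor_arr I runit lunit symm assoc
  for B :: "('o, 'm) bicat" (structure)
    and tensor_obj (infixr \<open>\<boxtimes>\<close> 75) and tensor_arr (infixr \<open>\<otimes>\<close> 75)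
    and I and runit and lunit and symm and assoc +
  fixes d t :: "'o \<Rightarrow> 'm"
  assumes comonoid: "X \<in> Obj B \<Longrightarrow> cocommutative_comonoid X (d X) (t X)"
    and comult_lax: "F \<in> hom B X Y \<Longrightarrow> d Y \<cdot> F \<preceq> (F \<otimes> F) \<cdot> d X"
    and counit_lax: "F \<in> hom B X Y \<Longrightarrow> t Y \<cdot> F \<preceq> t X"
    and comult_adjoint: "X \<in> Obj B \<Longrightarrow> has_right_adjoint B X (X \<boxtimes> X) (d X)"
    and counit_adjoint: "X \<in> Obj B \<Longrightarrow> has_right_adjoint B X I (t X)"

definition cartesian :: "('o, 'm) bicat \<Rightarrow> bool" where
  "cartesian B \<longleftrightarrow> (\<exists>tensor_obj tensor_arr I runit lunit symm assoc d t.
    cartesian_structure B tensor_obj tensor_arr I runit lunit symm assoc d t)"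

text \<open>
  An arrow \<open>R\<close> of the base can underlie arrows between several pairs of idempotents, so an arrow
  of the Karoubi bicategory is a triple of source, underlying arrow and target.
\<close>

definition kar_obj :: "('o, 'm) bicat \<Rightarrow> ('o \<times> 'm) set" where
  "kar_obj B = {(A, a). A \<in> Obj B \<and> a \<in> hom B A A \<and> Comp B a a = a}"

definition karoubi ::
  "('o, 'm) bicat \<Rightarrow> ('o \<times> 'm, ('o \<times> 'm) \<times> 'm \<times> ('o \<times> 'm)) bicat" where
  "karoubi B = \<lparr>
    Obj = kar_obj B,
    Arr = {((X, x), R, (A, a)) | X x R A a. (X, x) \<in> kar_obj B \<and> (A, a) \<in> kar_obj B \<and>
      R \<in> hom B X A \<and> Comp B (Comp B a R) x = R},
    Dom = (\<lambda>(p, R, q). p),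
    Cod = (\<lambda>(p, R, q). q),
    Ident = (\<lambda>(X, x). ((X, x), x, (X, x))),
    Comp = (\<lambda>(q, S, r) (p, R, q'). (p, Comp B S R, r)),
    Le = (\<lambda>(p, R, q) (p', S, q'). p = p' \<and> q = q' \<and> Le B R S)\<rparr>"

end

theory Submission
  imports Defs
begin

text \<open>
  The tensor product and its constraints lift to pairs \<open>(X, x)\<close> by composing with idempotents. The
  comultiplication on \<open>(X, x)\<close> is \<open>(x \<otimes> x) d x\<close> and the counit is \<open>t x\<close>. Since \<open>x\<close> is only a lax
  comonoid morphism, the comonoid equations are obtained by squeezing: \<open>d x = d x x \<le> (x \<otimes> x) d x\<close>
  gives one inequality, and the other follows from the laxity of \<open>d\<close> or \<open>t\<close> in a remaining factor
  that absorbs \<open>x \<otimes> x\<close>. For an arrow \<open>f\<close> with right adjoint \<open>g\<close> and \<open>f x \<le> y f\<close>, the lifted arrow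
  \<open>y f x\<close> has right adjoint \<open>x g y\<close>.
\<close>

section \<open>Equational calculus of arrows in a locally ordered bicategory\<close>

context locally_ordered_bicategory
begin

lemma hom_self: "F \<in> Arr B \<Longrightarrow> F \<in> hom B (Dom B F) (Cod B F)"
  by (simp add: hom_def)

lemma ident_arr [simp]:
  assumes "X \<in> Obj B"
  shows "\<one> X \<in> Arr B" "Dom B (\<one> X) = X" "Cod B (\<one> X) = X"
  using ident_hom[OF assms] by (auto simp: hom_def)

text \<open>In \<open>comp_hom\<close> the middle object occurs only in the premises, so rewriting
  cannot guess it. Phrased with \<open>Dom\<close> and \<open>Cod\<close>, typing conditions become
  equations that the simplifier discharges. The other axioms are restated below in the same
  form.\<close>

lemma comp_arr [simp]:
  assumes "F \<in> Arr B" "G \<in> Arr B" "Cod B F = Dom B G"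
  shows "G \<cdot> F \<in> Arr B" "Dom B (G \<cdot> F) = Dom B F" "Cod B (G \<cdot> F) = Cod B G"
proof -
  have "G \<cdot> F \<in> hom B (Dom B F) (Cod B G)"
    using assms by (intro comp_hom[where Y = "Dom B G"]) (auto simp: hom_def)
  then show "G \<cdot> F \<in> Arr B" "Dom B (G \<cdot> F) = Dom B F" "Cod B (G \<cdot> F) = Cod B G"
    by (auto simp: hom_def)
qed

lemma arr_obj [simp]:
  assumes "F \<in> Arr B"
  shows "Dom B F \<in> Obj B" "Cod B F \<in> Obj B"
  using dom_cod[OF assms] by auto

lemma ident_comp [simp]: "\<lbrakk>F \<in> Arr B; Cod B F = Y\<rbrakk> \<Longrightarrow> \<one> Y \<cdot> F = F"
  by (rule comp_ident_left) (auto simp: hom_def)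

lemma comp_ident [simp]: "\<lbrakk>F \<in> Arr B; Dom B F = X\<rbrakk> \<Longrightarrow> F \<cdot> \<one> X = F"
  by (rule comp_ident_right) (auto simp: hom_def)

lemma arr_comp_assoc [simp]:
  "\<lbrakk>F \<in> Arr B; G \<in> Arr B; H \<in> Arr B; Cod B F = Dom B G; Cod B G = Dom B H\<rbrakk>
    \<Longrightarrow> (H \<cdot> G) \<cdot> F = H \<cdot> (G \<cdot> F)"
  by (rule comp_assoc) (auto simp: hom_def)

text \<open>Composites are normalised to right-nested form, where the left side of
  \<open>G \<cdot> F = K\<close> no longer occurs once a further arrow \<open>H\<close> is composed
  on the right. This supplies the equation in the form that still matches.\<close>

lemma comp_eq_extend:
  assumes "G \<cdot> F = K" "F \<in> Arr B" "G \<in> Arr B" "Cod B F = Dom B G"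
    "H \<in> Arr B" "Cod B H = Dom B F"
  shows "G \<cdot> (F \<cdot> H) = K \<cdot> H"
  using arr_comp_assoc[of H F G] assms by simp

lemma arr_le_refl: "F \<in> Arr B \<Longrightarrow> F \<preceq> F"
  by (rule le_refl) (rule hom_self)

lemma arr_le_trans:
  assumes "F \<preceq> G" "G \<preceq> H" "F \<in> Arr B" "G \<in> Arr B" "H \<in> Arr B"
    "Dom B F = Dom B G" "Dom B G = Dom B H" "Cod B F = Cod B G" "Cod B G = Cod B H"
  shows "F \<preceq> H"
  by (rule le_trans[where X = "Dom B G" and Y = "Cod B G" and G = G]) (use assms in \<open>auto simp: hom_def\<close>)

lemma arr_antisym:
  "\<lbrakk>F \<preceq> G; G \<preceq> F; F \<in> Arr B; G \<in> Arr B; Dom B F = Dom B G; Cod B F = Cod B G\<rbrakk> \<Longrightarrow> F = G"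
  by (rule le_antisym) (auto simp: hom_def)

lemma arr_comp_mono:
  assumes "F \<preceq> F'" "G \<preceq> G'" "F \<in> Arr B" "F' \<in> Arr B" "G \<in> Arr B" "G' \<in> Arr B"
    "Dom B F = Dom B F'" "Cod B F = Cod B F'" "Dom B G = Dom B G'" "Cod B G = Cod B G'"
    "Cod B F = Dom B G"
  shows "G \<cdot> F \<preceq> G' \<cdot> F'"
  by (rule comp_mono[where X = "Dom B F" and Y = "Dom B G" and Z = "Cod B G"])
    (use assms in \<open>auto simp: hom_def\<close>)

lemma comp_mono_left:
  assumes "G \<preceq> G'" "F \<in> Arr B" "G \<in> Arr B" "G' \<in> Arr B"
    "Dom B G = Dom B G'" "Cod B G = Cod B G'" "Cod B F = Dom B G"
  shows "G \<cdot> F \<preceq> G' \<cdot> F"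
  using assms by (intro arr_comp_mono arr_le_refl) auto

lemma comp_mono_right:
  assumes "F \<preceq> F'" "F \<in> Arr B" "F' \<in> Arr B" "G \<in> Arr B"
    "Dom B F = Dom B F'" "Cod B F = Cod B F'" "Cod B F = Dom B G"
  shows "G \<cdot> F \<preceq> G \<cdot> F'"
  using assms by (intro arr_comp_mono arr_le_refl) auto

section \<open>Objects, arrows and order of the Karoubi bicategory\<close>

lemma kar_objD:
  assumes "(X, x) \<in> kar_obj B"
  shows "X \<in> Obj B" "x \<in> Arr B" "Dom B x = X" "Cod B x = X" "x \<cdot> x = x"
    "\<And>F. \<lbrakk>F \<in> Arr B; Cod B F = X\<rbrakk> \<Longrightarrow> x \<cdot> (x \<cdot> F) = x \<cdot> F"
proof -
  show x: "X \<in> Obj B" "x \<in> Arr B" "Dom B x = X" "Cod B x = X" "x \<cdot> x = x"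
    using assms by (auto simp: kar_obj_def hom_def)
  show "x \<cdot> (x \<cdot> F) = x \<cdot> F" if "F \<in> Arr B" "Cod B F = X" for F
    using comp_eq_extend[of x x x F] x that by simp
qed

lemma kar_objI:
  "\<lbrakk>x \<in> Arr B; Dom B x = X; Cod B x = X; x \<cdot> x = x\<rbrakk> \<Longrightarrow> (X, x) \<in> kar_obj B"
  by (auto simp: kar_obj_def hom_def)

text \<open>Since \<open>x\<close> and \<open>y\<close> are idempotent, composing
  \<open>y \<cdot> R \<cdot> x\<close> with another \<open>y\<close> or \<open>x\<close> changes
  nothing. The single condition on \<open>R\<close> therefore splits into two absorption equations,
  which serve as rewrite rules from here on.\<close>

lemma kar_hom_iff:
  "F \<in> hom (karoubi B) (X, x) (Y, y) \<longleftrightarrow>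
    (\<exists>R. F = ((X, x), R, (Y, y)) \<and> (X, x) \<in> kar_obj B \<and> (Y, y) \<in> kar_obj B \<and>
      R \<in> Arr B \<and> Dom B R = X \<and> Cod B R = Y \<and> y \<cdot> R = R \<and> R \<cdot> x = R)"
  (is "?L \<longleftrightarrow> ?R")
proof
  assume ?L
  then obtain R where R: "F = ((X, x), R, (Y, y))" "R \<in> hom B X Y" "(y \<cdot> R) \<cdot> x = R"
    and x: "(X, x) \<in> kar_obj B" and y: "(Y, y) \<in> kar_obj B"
    by (auto simp: hom_def karoubi_def)
  note [simp] = kar_objD[OF x] kar_objD[OF y]
  have r [simp]: "R \<in> Arr B" "Dom B R = X" "Cod B R = Y"
    using R(2) by (auto simp: hom_def)
  have e: "y \<cdot> (R \<cdot> x) = R"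
    using R(3) by simp
  have "y \<cdot> (y \<cdot> (R \<cdot> x)) = y \<cdot> (R \<cdot> x)" "(y \<cdot> (R \<cdot> x)) \<cdot> x = y \<cdot> (R \<cdot> x)"
    by simp_all
  then have "y \<cdot> R = R" "R \<cdot> x = R"
    unfolding e by simp_all
  with R(1) x y r show ?R
    by blast
next
  assume ?R
  then show ?L
    by (auto simp: hom_def karoubi_def)
qed

lemma kar_homE:
  assumes "F \<in> hom (karoubi B) (X, x) (Y, y)"
  obtains R where "F = ((X, x), R, (Y, y))" "(X, x) \<in> kar_obj B" "(Y, y) \<in> kar_obj B"
    "R \<in> Arr B" "Dom B R = X" "Cod B R = Y" "y \<cdot> R = R" "R \<cdot> x = R"
  using assms unfolding kar_hom_iff by blast

lemma kar_homI:
  "\<lbrakk>(X, x) \<in> kar_obj B; (Y, y) \<in> kar_obj B; R \<in> Arr B; Dom B R = X; Cod B R = Y;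
    y \<cdot> R = R; R \<cdot> x = R\<rbrakk> \<Longrightarrow> ((X, x), R, (Y, y)) \<in> hom (karoubi B) (X, x) (Y, y)"
  unfolding kar_hom_iff by blast

lemma kar_simps [simp]:
  "Obj (karoubi B) = kar_obj B"
  "Ident (karoubi B) (X, x) = ((X, x), x, (X, x))"
  "Comp (karoubi B) (q', S, r) (p, R, q) = (p, S \<cdot> R, r)"
  "Le (karoubi B) (p, R, q) (p', S, q') \<longleftrightarrow> p = p' \<and> q = q' \<and> R \<preceq> S"
  by (simp_all add: karoubi_def)

text \<open>Associativity and the order are inherited from the underlying arrows. The identity laws
  are exactly the two absorption equations, and a composite absorbs at its ends because its outer
  factors do.\<close>

lemma locally_ordered_bicategory_karoubi: "locally_ordered_bicategory (karoubi B)"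
proof
  fix F
  assume "F \<in> Arr (karoubi B)"
  then show "Dom (karoubi B) F \<in> Obj (karoubi B) \<and> Cod (karoubi B) F \<in> Obj (karoubi B)"
    by (auto simp: karoubi_def)
next
  fix X
  assume "X \<in> Obj (karoubi B)"
  then show "Ident (karoubi B) X \<in> hom (karoubi B) X X"
    by (cases X) (auto intro!: kar_homI dest: kar_objD)
next
  fix F X Y G Z
  assume "F \<in> hom (karoubi B) X Y" "G \<in> hom (karoubi B) Y Z"
  then show "Comp (karoubi B) G F \<in> hom (karoubi B) X Z"
    by (cases X; cases Y; cases Z)
      (auto elim!: kar_homE intro!: kar_homI simp: kar_objD comp_eq_extend)
next
  fix F X Y
  assume "F \<in> hom (karoubi B) X Y"
  then show "Comp (karoubi B) (Ident (karoubi B) Y) F = F"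
    "Comp (karoubi B) F (Ident (karoubi B) X) = F"
    by (cases X; cases Y; auto elim!: kar_homE)+
next
  fix F W X G Y H Z
  assume "F \<in> hom (karoubi B) W X" "G \<in> hom (karoubi B) X Y" "H \<in> hom (karoubi B) Y Z"
  then show "Comp (karoubi B) (Comp (karoubi B) H G) F = Comp (karoubi B) H (Comp (karoubi B) G F)"
    by (cases W; cases X; cases Y; cases Z) (auto elim!: kar_homE)
next
  fix F X Y
  assume "F \<in> hom (karoubi B) X Y"
  then show "Le (karoubi B) F F"
    by (cases X; cases Y) (auto elim!: kar_homE intro: arr_le_refl)
next
  fix F X Y G H
  assume "F \<in> hom (karoubi B) X Y" "G \<in> hom (karoubi B) X Y" "H \<in> hom (karoubi B) X Y"
    and le: "Le (karoubi B) F G" "Le (karoubi B) G H"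
  moreover obtain A a C c where "X = (A, a)" "Y = (C, c)"
    by (cases X; cases Y)
  ultimately obtain R S T where
    "F = ((A, a), R, (C, c))" "R \<in> Arr B" "Dom B R = A" "Cod B R = C"
    "G = ((A, a), S, (C, c))" "S \<in> Arr B" "Dom B S = A" "Cod B S = C"
    "H = ((A, a), T, (C, c))" "T \<in> Arr B" "Dom B T = A" "Cod B T = C"
    by (auto elim!: kar_homE)
  then show "Le (karoubi B) F H"
    using le arr_le_trans[of R S T] by simp
next
  fix F X Y G
  assume "F \<in> hom (karoubi B) X Y" "G \<in> hom (karoubi B) X Y"
    "Le (karoubi B) F G" "Le (karoubi B) G F"
  then show "F = G"
    by (cases X; cases Y) (auto elim!: kar_homE intro: arr_antisym)
next
  fix F X Y F' G Z G'
  assume "F \<in> hom (karoubi B) X Y" "F' \<in> hom (karoubi B) X Y"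
    "G \<in> hom (karoubi B) Y Z" "G' \<in> hom (karoubi B) Y Z"
    "Le (karoubi B) F F'" "Le (karoubi B) G G'"
  then show "Le (karoubi B) (Comp (karoubi B) G F) (Comp (karoubi B) G' F')"
    by (cases X; cases Y; cases Z) (auto elim!: kar_homE simp: arr_comp_mono)
qed

text \<open>If \<open>h\<close> is inverse to \<open>k\<close>, then \<open>x \<cdot> h\<close> is
  inverse to \<open>k \<cdot> x\<close>. Commutation of \<open>k\<close> with the idempotents makes
  both arrows absorb the idempotents at their ends. For the structural constraints this commutation
  is naturality.\<close>

lemma kar_iso:
  assumes k: "is_iso B X Y k" and x: "(X, x) \<in> kar_obj B" and y: "(Y, y) \<in> kar_obj B"
    and natural: "k \<cdot> x = y \<cdot> k"
  shows "is_iso (karoubi B) (X, x) (Y, y) ((X, x), k \<cdot> x, (Y, y))"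
proof -
  note [simp] = kar_objD[OF x] kar_objD[OF y]
  from k obtain h where [simp]: "k \<in> Arr B" "Dom B k = X" "Cod B k = Y"
      "h \<in> Arr B" "Dom B h = Y" "Cod B h = X" and hk: "h \<cdot> k = \<one> X" and kh: "k \<cdot> h = \<one> Y"
    by (auto simp: is_iso_def hom_def)
  have hk' [simp]: "h \<cdot> (k \<cdot> F) = F" if "F \<in> Arr B" "Cod B F = X" for F
    using comp_eq_extend[OF hk, of F] that by simp
  have natural' [simp]: "k \<cdot> (x \<cdot> F) = y \<cdot> (k \<cdot> F)" if "F \<in> Arr B" "Cod B F = X" for F
    using comp_eq_extend[OF natural, of F] that by simp
  have xh: "x \<cdot> h \<in> Arr B" "(x \<cdot> h) \<cdot> y = x \<cdot> h"
  proof -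
    \<comment> \<open>Inserting \<open>k \<cdot> h\<close> allows \<open>y\<close> to be moved
      across \<open>k\<close>, after which \<open>h \<cdot> k\<close> cancels; so \<open>h\<close>
      commutes with the idempotents as well.\<close>
    have "h \<cdot> y = h \<cdot> (y \<cdot> (k \<cdot> h))"
      by (simp add: kh)
    also have "\<dots> = h \<cdot> (k \<cdot> (x \<cdot> h))"
      by simp
    also have "\<dots> = x \<cdot> h"
      by (rule hk') simp_all
    finally show "(x \<cdot> h) \<cdot> y = x \<cdot> h"
      by simp
  qed simp
  have fwd: "((X, x), k \<cdot> x, (Y, y)) \<in> hom (karoubi B) (X, x) (Y, y)"
    using x y by (intro kar_homI) (simp_all add: natural)
  have bwd: "((Y, y), x \<cdot> h, (X, x)) \<in> hom (karoubi B) (Y, y) (X, x)"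
    using x y xh by (intro kar_homI) simp_all
  have "(x \<cdot> h) \<cdot> (k \<cdot> x) = x"
    using hk'[of x] by (simp del: natural')
  moreover have "(k \<cdot> x) \<cdot> (x \<cdot> h) = y"
    by (simp add: kh)
  ultimately show ?thesis
    unfolding is_iso_def using fwd bwd by (auto intro!: bexI[of _ "((Y, y), x \<cdot> h, (X, x))"])
qed

text \<open>Laxity serves both adjunction inequalities: in the unit it inserts the idempotent
  \<open>y\<close> between \<open>g\<close> and \<open>f\<close>, and in the counit it removes the
  idempotent \<open>x\<close> between \<open>f\<close> and \<open>g\<close>. For \<open>d\<close>
  and \<open>t\<close> the hypothesis \<open>lax\<close> is their lax naturality at an
  idempotent.\<close>

lemma kar_adjoint:
  assumes f: "has_right_adjoint B X Y f" and x: "(X, x) \<in> kar_obj B" and y: "(Y, y) \<in> kar_obj B"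
    and lax: "f \<cdot> x \<preceq> y \<cdot> f"
  shows "has_right_adjoint (karoubi B) (X, x) (Y, y) ((X, x), y \<cdot> (f \<cdot> x), (Y, y))"
proof -
  note [simp] = kar_objD[OF x] kar_objD[OF y]
  from f obtain g where [simp]: "f \<in> Arr B" "Dom B f = X" "Cod B f = Y"
      "g \<in> Arr B" "Dom B g = Y" "Cod B g = X"
      and unit: "\<one> X \<preceq> g \<cdot> f" and counit: "f \<cdot> g \<preceq> \<one> Y"
    by (auto simp: has_right_adjoint_def hom_def)
  have fwd: "((X, x), y \<cdot> (f \<cdot> x), (Y, y)) \<in> hom (karoubi B) (X, x) (Y, y)"
    using x y by (intro kar_homI) simp_all
  have bwd: "((Y, y), x \<cdot> (g \<cdot> y), (X, x)) \<in> hom (karoubi B) (Y, y) (X, x)"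
    using x y by (intro kar_homI) simp_all
  have "x \<cdot> (\<one> X \<cdot> x) \<preceq> x \<cdot> ((g \<cdot> f) \<cdot> x)"
    by (rule comp_mono_right[OF comp_mono_left[OF unit]]) simp_all
  \<comment> \<open>The trailing \<open>x\<close> is duplicated, so that one copy can be traded for
    \<open>y\<close> in front of \<open>f\<close> while the other stays.\<close>
  moreover have "x \<cdot> (g \<cdot> ((f \<cdot> x) \<cdot> x)) \<preceq> x \<cdot> (g \<cdot> ((y \<cdot> f) \<cdot> x))"
    by (rule comp_mono_right[OF comp_mono_right[OF comp_mono_left[OF lax]]]) simp_all
  ultimately have 1: "x \<preceq> x \<cdot> (g \<cdot> (y \<cdot> (f \<cdot> x)))"
    by (auto intro: arr_le_trans[of _ "x \<cdot> (g \<cdot> (f \<cdot> x))"])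
  \<comment> \<open>Here the inner \<open>x\<close> becomes a \<open>y\<close>, which the outer
    \<open>y\<close> absorbs.\<close>
  have "y \<cdot> ((f \<cdot> x) \<cdot> (g \<cdot> y)) \<preceq> y \<cdot> ((y \<cdot> f) \<cdot> (g \<cdot> y))"
    by (rule comp_mono_right[OF comp_mono_left[OF lax]]) simp_all
  moreover have "y \<cdot> ((f \<cdot> g) \<cdot> y) \<preceq> y \<cdot> (\<one> Y \<cdot> y)"
    by (rule comp_mono_right[OF comp_mono_left[OF counit]]) simp_all
  ultimately have 2: "y \<cdot> (f \<cdot> (x \<cdot> (g \<cdot> y))) \<preceq> y"
    by (auto intro: arr_le_trans[of _ "y \<cdot> (f \<cdot> (g \<cdot> y))"])
  show ?thesis
    unfolding has_right_adjoint_def using fwd bwd 1 2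
    by (auto intro!: bexI[of _ "((Y, y), x \<cdot> (g \<cdot> y), (X, x))"])
qed

end

section \<open>Equational calculus of the tensor product\<close>

context tensor_product
begin

lemma tensor_arr [simp]:
  assumes "F \<in> Arr B" "G \<in> Arr B"
  shows "F \<otimes> G \<in> Arr B" "Dom B (F \<otimes> G) = Dom B F \<boxtimes> Dom B G"
    "Cod B (F \<otimes> G) = Cod B F \<boxtimes> Cod B G"
  using tensor_arr_hom[OF hom_self hom_self, OF assms] by (auto simp: hom_def)

declare tensor_obj_closed [simp] unit_obj [simp]

lemma constraint_arr [simp]:
  assumes "X \<in> Obj B"
  shows "\<rho> X \<in> Arr B" "Dom B (\<rho> X) = X" "Cod B (\<rho> X) = X \<boxtimes> I"
    "\<ll> X \<in> Arr B" "Dom B (\<ll> X) = X" "Cod B (\<ll> X) = I \<boxtimes> X"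
  using runit_iso[OF assms] lunit_iso[OF assms] by (auto simp: is_iso_def hom_def)

lemma symm_arr [simp]:
  assumes "X \<in> Obj B" "Y \<in> Obj B"
  shows "\<gamma> X Y \<in> Arr B" "Dom B (\<gamma> X Y) = X \<boxtimes> Y" "Cod B (\<gamma> X Y) = Y \<boxtimes> X"
  using symm_iso[OF assms] by (auto simp: is_iso_def hom_def)

lemma assoc_arr [simp]:
  assumes "X \<in> Obj B" "Y \<in> Obj B" "Z \<in> Obj B"
  shows "\<alpha> X Y Z \<in> Arr B" "Dom B (\<alpha> X Y Z) = (X \<boxtimes> Y) \<boxtimes> Z"
    "Cod B (\<alpha> X Y Z) = X \<boxtimes> (Y \<boxtimes> Z)"
  using assoc_iso[OF assms] by (auto simp: is_iso_def hom_def)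

text \<open>Oriented to merge a composite of tensors into one tensor of composites, so that
  idempotency and absorption can be applied in each factor.\<close>

lemma interchange:
  "\<lbrakk>F \<in> Arr B; F' \<in> Arr B; G \<in> Arr B; G' \<in> Arr B; Cod B F = Dom B F'; Cod B G = Dom B G'\<rbrakk>
    \<Longrightarrow> (F' \<otimes> G') \<cdot> (F \<otimes> G) = (F' \<cdot> F) \<otimes> (G' \<cdot> G)"
  by (rule tensor_comp[symmetric]) (auto simp: hom_def)

text \<open>The corner objects are written as domains and codomains, so that naming the arrows fixes
  the whole square. The orientation moves arrows to the right of the constraint, towards the form in
  which the idempotents are collected. The four squares share their assumptions, so instances always
  name three arrows.\<close>

lemma arr_natural:
  assumes "F \<in> Arr B" "G \<in> Arr B" "H \<in> Arr B"
  shows "(F \<otimes> \<one> I) \<cdot> \<rho> (Dom B F) = \<rho> (Cod B F) \<cdot> F"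
    "(\<one> I \<otimes> F) \<cdot> \<ll> (Dom B F) = \<ll> (Cod B F) \<cdot> F"
    "(G \<otimes> F) \<cdot> \<gamma> (Dom B F) (Dom B G) = \<gamma> (Cod B F) (Cod B G) \<cdot> (F \<otimes> G)"
    "(F \<otimes> (G \<otimes> H)) \<cdot> \<alpha> (Dom B F) (Dom B G) (Dom B H)
      = \<alpha> (Cod B F) (Cod B G) (Cod B H) \<cdot> ((F \<otimes> G) \<otimes> H)"
  using assms by (auto intro: hom_self runit_natural[symmetric] lunit_natural[symmetric]
      symm_natural[symmetric] assoc_natural[symmetric])

lemma arr_tensor_mono:
  assumes "F \<preceq> F'" "G \<preceq> G'" "F \<in> Arr B" "F' \<in> Arr B" "G \<in> Arr B" "G' \<in> Arr B"
    "Dom B F = Dom B F'" "Cod B F = Cod B F'" "Dom B G = Dom B G'" "Cod B G = Cod B G'"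
  shows "F \<otimes> G \<preceq> F' \<otimes> G'"
  by (rule tensor_mono[where X = "Dom B F" and X' = "Cod B F" and Y = "Dom B G" and Y' = "Cod B G"])
    (use assms in \<open>auto simp: hom_def\<close>)

section \<open>Tensor product on the Karoubi bicategory\<close>

definition kar_tensor_obj :: "'o \<times> 'm \<Rightarrow> 'o \<times> 'm \<Rightarrow> 'o \<times> 'm" where
  "kar_tensor_obj = (\<lambda>(X, x) (Y, y). (X \<boxtimes> Y, x \<otimes> y))"

definition kar_tensor_arr where
  "kar_tensor_arr =
    (\<lambda>(p, R, q) (p', R', q'). (kar_tensor_obj p p', R \<otimes> R', kar_tensor_obj q q'))"

definition kar_unit :: "'o \<times> 'm" where
  "kar_unit = (I, \<one> I)"

text \<open>One idempotent suffices: by naturality \<open>\<rho> X \<cdot> x\<close> is also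
  \<open>(x \<otimes> \<one> I) \<cdot> \<rho> X\<close>, so it absorbs the idempotents at both
  ends. The other three constraints follow the same pattern.\<close>

definition kar_runit where
  "kar_runit = (\<lambda>(X, x). ((X, x), \<rho> X \<cdot> x, kar_tensor_obj (X, x) kar_unit))"

definition kar_lunit where
  "kar_lunit = (\<lambda>(X, x). ((X, x), \<ll> X \<cdot> x, kar_tensor_obj kar_unit (X, x)))"

definition kar_symm where
  "kar_symm = (\<lambda>(X, x) (Y, y). (kar_tensor_obj (X, x) (Y, y), \<gamma> X Y \<cdot> (x \<otimes> y),
    kar_tensor_obj (Y, y) (X, x)))"

definition kar_assoc where
  "kar_assoc = (\<lambda>(X, x) (Y, y) (Z, z).
    (kar_tensor_obj (kar_tensor_obj (X, x) (Y, y)) (Z, z), \<alpha> X Y Z \<cdot> ((x \<otimes> y) \<otimes> z),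
     kar_tensor_obj (X, x) (kar_tensor_obj (Y, y) (Z, z))))"

lemma kar_tensor_simps [simp]:
  "kar_tensor_obj (X, x) (Y, y) = (X \<boxtimes> Y, x \<otimes> y)"
  "kar_tensor_arr (p, R, q) (p', R', q') = (kar_tensor_obj p p', R \<otimes> R', kar_tensor_obj q q')"
  "kar_runit (X, x) = ((X, x), \<rho> X \<cdot> x, (X \<boxtimes> I, x \<otimes> \<one> I))"
  "kar_lunit (X, x) = ((X, x), \<ll> X \<cdot> x, (I \<boxtimes> X, \<one> I \<otimes> x))"
  "kar_symm (X, x) (Y, y) = ((X \<boxtimes> Y, x \<otimes> y), \<gamma> X Y \<cdot> (x \<otimes> y), (Y \<boxtimes> X, y \<otimes> x))"
  "kar_assoc (X, x) (Y, y) (Z, z) =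
    (((X \<boxtimes> Y) \<boxtimes> Z, (x \<otimes> y) \<otimes> z), \<alpha> X Y Z \<cdot> ((x \<otimes> y) \<otimes> z), (X \<boxtimes> (Y \<boxtimes> Z), x \<otimes> (y \<otimes> z)))"
  by (simp_all add: kar_tensor_obj_def kar_tensor_arr_def kar_unit_def kar_runit_def
      kar_lunit_def kar_symm_def kar_assoc_def)

lemma kar_unit_obj: "(I, \<one> I) \<in> kar_obj B"
  by (rule kar_objI) simp_all

lemma kar_tensor_obj_closed:
  "\<lbrakk>(X, x) \<in> kar_obj B; (Y, y) \<in> kar_obj B\<rbrakk> \<Longrightarrow> (X \<boxtimes> Y, x \<otimes> y) \<in> kar_obj B"
  by (rule kar_objI) (simp_all add: kar_objD interchange)

text \<open>
  The constraints of the Karoubi bicategory have the form \<open>k \<cdot> e\<close>, where \<open>k\<close> is a constraint of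
  \<open>B\<close> and \<open>e\<close> is idempotent. A composite of such arrows has this form again, which reduces the
  coherence conditions to those of \<open>B\<close>.
\<close>

lemma comp_lift:
  assumes "e' \<cdot> k = k \<cdot> e" "e \<cdot> e = e" "m \<in> Arr B" "e' \<in> Arr B" "k \<in> Arr B" "e \<in> Arr B"
    "Dom B e' = Dom B m" "Cod B e' = Dom B m" "Cod B k = Dom B m" "Dom B e = Dom B k" "Cod B e = Dom B k"
  shows "(m \<cdot> e') \<cdot> (k \<cdot> e) = (m \<cdot> k) \<cdot> e"
proof -
  have "(m \<cdot> e') \<cdot> (k \<cdot> e) = m \<cdot> ((e' \<cdot> k) \<cdot> e)"
    using assms(3-) by simp
  \<comment> \<open>The inner idempotent \<open>e'\<close> crosses \<open>k\<close>, turns into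
    \<open>e\<close>, and meets the \<open>e\<close> already there.\<close>
  also have "\<dots> = (m \<cdot> k) \<cdot> (e \<cdot> e)"
    unfolding assms(1) using assms(3-) by simp
  finally show ?thesis
    using assms(2) by simp
qed

text \<open>On the two-edge path \<open>comp_lift\<close> gathers the idempotents at the right end.
  The pentagon of \<open>B\<close> then exchanges the paths, and two uses of
  \<open>comp_lift\<close> read backwards redistribute the idempotents over the three edges of the
  other path.\<close>

lemma kar_pentagon:
  assumes w: "(W, w) \<in> kar_obj B" and x: "(X, x) \<in> kar_obj B" and y: "(Y, y) \<in> kar_obj B"
    and z: "(Z, z) \<in> kar_obj B"
  shows "(\<alpha> W X (Y \<boxtimes> Z) \<cdot> ((w \<otimes> x) \<otimes> (y \<otimes> z))) \<cdot> (\<alpha> (W \<boxtimes> X) Y Z \<cdot> (((w \<otimes> x) \<otimes> y) \<otimes> z))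
    = (w \<otimes> (\<alpha> X Y Z \<cdot> ((x \<otimes> y) \<otimes> z))) \<cdot> ((\<alpha> W (X \<boxtimes> Y) Z \<cdot> ((w \<otimes> (x \<otimes> y)) \<otimes> z))
      \<cdot> ((\<alpha> W X Y \<cdot> ((w \<otimes> x) \<otimes> y)) \<otimes> z))"
    (is "?lhs = ?rhs")
proof -
  note [simp] = kar_objD[OF w] kar_objD[OF x] kar_objD[OF y] kar_objD[OF z]
  let ?e = "((w \<otimes> x) \<otimes> y) \<otimes> z"
  have "?lhs = (\<alpha> W X (Y \<boxtimes> Z) \<cdot> \<alpha> (W \<boxtimes> X) Y Z) \<cdot> ?e"
    using arr_natural(4)[of "w \<otimes> x" y z] by (intro comp_lift) (simp_all add: interchange)
  also have "\<dots> = ((\<one> W \<otimes> \<alpha> X Y Z) \<cdot> (\<alpha> W (X \<boxtimes> Y) Z \<cdot> (\<alpha> W X Y \<otimes> \<one> Z))) \<cdot> ?e"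
    by (subst pentagon) simp_all
  also have "\<dots> = ((\<one> W \<otimes> \<alpha> X Y Z) \<cdot> (w \<otimes> ((x \<otimes> y) \<otimes> z))) \<cdot> ((\<alpha> W (X \<boxtimes> Y) Z \<cdot> (\<alpha> W X Y \<otimes> \<one> Z)) \<cdot> ?e)"
  proof (rule comp_lift[symmetric])
    \<comment> \<open>The arrow to be crossed consists of two edges, so the idempotent passes them
      one after the other, each time by naturality of \<alpha>.\<close>
    have "(w \<otimes> ((x \<otimes> y) \<otimes> z)) \<cdot> (\<alpha> W (X \<boxtimes> Y) Z \<cdot> (\<alpha> W X Y \<otimes> \<one> Z))
        = (\<alpha> W (X \<boxtimes> Y) Z \<cdot> ((w \<otimes> (x \<otimes> y)) \<otimes> z)) \<cdot> (\<alpha> W X Y \<otimes> \<one> Z)"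
      using arr_natural(4)[of w "x \<otimes> y" z] by (intro comp_eq_extend) simp_all
    also have "\<dots> = \<alpha> W (X \<boxtimes> Y) Z \<cdot> (\<alpha> W X Y \<otimes> \<one> Z) \<cdot> ?e"
      using arr_natural(4)[of w x y] by (simp add: interchange)
    finally show "(w \<otimes> ((x \<otimes> y) \<otimes> z)) \<cdot> (\<alpha> W (X \<boxtimes> Y) Z \<cdot> (\<alpha> W X Y \<otimes> \<one> Z))
        = (\<alpha> W (X \<boxtimes> Y) Z \<cdot> (\<alpha> W X Y \<otimes> \<one> Z)) \<cdot> ?e"
      by simp
  qed (simp_all add: interchange)
  also have "(\<alpha> W (X \<boxtimes> Y) Z \<cdot> (\<alpha> W X Y \<otimes> \<one> Z)) \<cdot> ?e
      = (\<alpha> W (X \<boxtimes> Y) Z \<cdot> ((w \<otimes> (x \<otimes> y)) \<otimes> z)) \<cdot> ((\<alpha> W X Y \<otimes> \<one> Z) \<cdot> ?e)"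
    using arr_natural(4)[of w x y] by (intro comp_lift[symmetric]) (simp_all add: interchange)
  also have "(\<one> W \<otimes> \<alpha> X Y Z) \<cdot> (w \<otimes> ((x \<otimes> y) \<otimes> z)) = w \<otimes> (\<alpha> X Y Z \<cdot> ((x \<otimes> y) \<otimes> z))"
    by (simp add: interchange)
  also have "(\<alpha> W X Y \<otimes> \<one> Z) \<cdot> ?e = (\<alpha> W X Y \<cdot> ((w \<otimes> x) \<otimes> y)) \<otimes> z"
    by (simp add: interchange)
  finally show ?thesis .
qed

lemma kar_triangle:
  assumes x: "(X, x) \<in> kar_obj B" and y: "(Y, y) \<in> kar_obj B"
  shows "(\<alpha> X I Y \<cdot> ((x \<otimes> \<one> I) \<otimes> y)) \<cdot> ((\<rho> X \<cdot> x) \<otimes> y) = x \<otimes> (\<ll> Y \<cdot> y)"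
    (is "?lhs = ?rhs")
proof -
  note [simp] = kar_objD[OF x] kar_objD[OF y]
  have "(\<rho> X \<cdot> x) \<otimes> y = (\<rho> X \<otimes> \<one> Y) \<cdot> (x \<otimes> y)"
    by (simp add: interchange)
  then have "?lhs = (\<alpha> X I Y \<cdot> ((x \<otimes> \<one> I) \<otimes> y)) \<cdot> ((\<rho> X \<otimes> \<one> Y) \<cdot> (x \<otimes> y))"
    by simp
  also have "\<dots> = (\<alpha> X I Y \<cdot> (\<rho> X \<otimes> \<one> Y)) \<cdot> (x \<otimes> y)"
    using arr_natural(1)[of x x x] by (intro comp_lift) (simp_all add: interchange)
  also have "\<dots> = (\<one> X \<otimes> \<ll> Y) \<cdot> (x \<otimes> y)"
    by (subst triangle) simp_all
  also have "\<dots> = ?rhs"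
    by (simp add: interchange)
  finally show ?thesis .
qed

text \<open>Both paths have three edges. Two uses of \<open>comp_lift\<close> gather the idempotents
  on the first, the hexagon of \<open>B\<close> exchanges the paths, and two reversed uses spread
  them over the second.\<close>

lemma kar_hexagon:
  assumes x: "(X, x) \<in> kar_obj B" and y: "(Y, y) \<in> kar_obj B" and z: "(Z, z) \<in> kar_obj B"
  shows "(\<alpha> Y Z X \<cdot> ((y \<otimes> z) \<otimes> x)) \<cdot> ((\<gamma> X (Y \<boxtimes> Z) \<cdot> (x \<otimes> (y \<otimes> z))) \<cdot> (\<alpha> X Y Z \<cdot> ((x \<otimes> y) \<otimes> z)))
    = (y \<otimes> (\<gamma> X Z \<cdot> (x \<otimes> z))) \<cdot> ((\<alpha> Y X Z \<cdot> ((y \<otimes> x) \<otimes> z)) \<cdot> ((\<gamma> X Y \<cdot> (x \<otimes> y)) \<otimes> z))"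
    (is "?lhs = ?rhs")
proof -
  note [simp] = kar_objD[OF x] kar_objD[OF y] kar_objD[OF z]
  let ?e = "(x \<otimes> y) \<otimes> z"
  note a = arr_natural(4)[of x y z] and a' = arr_natural(4)[of y x z]
    and g = arr_natural(3)[of x "y \<otimes> z" x] and g' = arr_natural(3)[of x y x]
  have "(\<gamma> X (Y \<boxtimes> Z) \<cdot> (x \<otimes> (y \<otimes> z))) \<cdot> (\<alpha> X Y Z \<cdot> ?e) = (\<gamma> X (Y \<boxtimes> Z) \<cdot> \<alpha> X Y Z) \<cdot> ?e"
    using a by (intro comp_lift) (simp_all add: interchange)
  then have "?lhs = (\<alpha> Y Z X \<cdot> ((y \<otimes> z) \<otimes> x)) \<cdot> ((\<gamma> X (Y \<boxtimes> Z) \<cdot> \<alpha> X Y Z) \<cdot> ?e)"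
    by (rule arg_cong)
  also have "\<dots> = (\<alpha> Y Z X \<cdot> (\<gamma> X (Y \<boxtimes> Z) \<cdot> \<alpha> X Y Z)) \<cdot> ?e"
  proof (rule comp_lift)
    have "((y \<otimes> z) \<otimes> x) \<cdot> (\<gamma> X (Y \<boxtimes> Z) \<cdot> \<alpha> X Y Z)
        = (\<gamma> X (Y \<boxtimes> Z) \<cdot> (x \<otimes> (y \<otimes> z))) \<cdot> \<alpha> X Y Z"
      using g by (intro comp_eq_extend) simp_all
    also have "\<dots> = (\<gamma> X (Y \<boxtimes> Z) \<cdot> \<alpha> X Y Z) \<cdot> ?e"
      using a by simp
    finally show "((y \<otimes> z) \<otimes> x) \<cdot> (\<gamma> X (Y \<boxtimes> Z) \<cdot> \<alpha> X Y Z)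
        = (\<gamma> X (Y \<boxtimes> Z) \<cdot> \<alpha> X Y Z) \<cdot> ?e" .
  qed (simp_all add: interchange)
  also have "\<dots> = ((\<one> Y \<otimes> \<gamma> X Z) \<cdot> (\<alpha> Y X Z \<cdot> (\<gamma> X Y \<otimes> \<one> Z))) \<cdot> ?e"
    by (subst hexagon) simp_all
  also have "\<dots> = ((\<one> Y \<otimes> \<gamma> X Z) \<cdot> (y \<otimes> (x \<otimes> z))) \<cdot> ((\<alpha> Y X Z \<cdot> (\<gamma> X Y \<otimes> \<one> Z)) \<cdot> ?e)"
  proof (rule comp_lift[symmetric])
    have "(y \<otimes> (x \<otimes> z)) \<cdot> (\<alpha> Y X Z \<cdot> (\<gamma> X Y \<otimes> \<one> Z))
        = (\<alpha> Y X Z \<cdot> ((y \<otimes> x) \<otimes> z)) \<cdot> (\<gamma> X Y \<otimes> \<one> Z)"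
      using a' by (intro comp_eq_extend) simp_all
    also have "\<dots> = (\<alpha> Y X Z \<cdot> (\<gamma> X Y \<otimes> \<one> Z)) \<cdot> ?e"
      using g' by (simp add: interchange)
    finally show "(y \<otimes> (x \<otimes> z)) \<cdot> (\<alpha> Y X Z \<cdot> (\<gamma> X Y \<otimes> \<one> Z))
        = (\<alpha> Y X Z \<cdot> (\<gamma> X Y \<otimes> \<one> Z)) \<cdot> ?e" .
  qed (simp_all add: interchange)
  also have "(\<alpha> Y X Z \<cdot> (\<gamma> X Y \<otimes> \<one> Z)) \<cdot> ?e
      = (\<alpha> Y X Z \<cdot> ((y \<otimes> x) \<otimes> z)) \<cdot> ((\<gamma> X Y \<otimes> \<one> Z) \<cdot> ?e)"
    using g' by (intro comp_lift[symmetric]) (simp_all add: interchange)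
  also have "(\<one> Y \<otimes> \<gamma> X Z) \<cdot> (y \<otimes> (x \<otimes> z)) = y \<otimes> (\<gamma> X Z \<cdot> (x \<otimes> z))"
    by (simp add: interchange)
  also have "(\<gamma> X Y \<otimes> \<one> Z) \<cdot> ?e = (\<gamma> X Y \<cdot> (x \<otimes> y)) \<otimes> z"
    by (simp add: interchange)
  finally show ?thesis .
qed

text \<open>Functoriality holds factor by factor, the constraints are invertible by
  \<open>kar_iso\<close>, and naturality comes from the squares of \<open>B\<close> because arrows
  absorb the idempotents at their ends.\<close>

lemma tensor_product_karoubi:
  "tensor_product (karoubi B) kar_tensor_obj kar_tensor_arr kar_unit kar_runit kar_lunit
    kar_symm kar_assoc"
proof (intro tensor_product.intro locally_ordered_bicategory_karoubi tensor_product_axioms.intro)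
  fix X Y
  assume "X \<in> Obj (karoubi B)" "Y \<in> Obj (karoubi B)"
  then show "kar_tensor_obj X Y \<in> Obj (karoubi B)"
    by (cases X; cases Y) (simp add: kar_tensor_obj_closed)
next
  fix F X X' G Y Y'
  assume "F \<in> hom (karoubi B) X X'" "G \<in> hom (karoubi B) Y Y'"
  then show "kar_tensor_arr F G \<in> hom (karoubi B) (kar_tensor_obj X Y) (kar_tensor_obj X' Y')"
    by (cases X; cases X'; cases Y; cases Y')
      (auto elim!: kar_homE intro!: kar_homI simp: kar_tensor_obj_closed interchange kar_objD)
next
  fix X Y
  assume "X \<in> Obj (karoubi B)" "Y \<in> Obj (karoubi B)"
  then show "kar_tensor_arr (Ident (karoubi B) X) (Ident (karoubi B) Y)
      = Ident (karoubi B) (kar_tensor_obj X Y)"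
    by (cases X; cases Y) simp
next
  fix F X X' F' X'' G Y Y' G' Y''
  assume "F \<in> hom (karoubi B) X X'" "F' \<in> hom (karoubi B) X' X''"
    "G \<in> hom (karoubi B) Y Y'" "G' \<in> hom (karoubi B) Y' Y''"
  then show "kar_tensor_arr (Comp (karoubi B) F' F) (Comp (karoubi B) G' G)
      = Comp (karoubi B) (kar_tensor_arr F' G') (kar_tensor_arr F G)"
    by (cases X; cases X'; cases X''; cases Y; cases Y'; cases Y'')
      (auto elim!: kar_homE simp: interchange)
next
  fix F X X' F' G Y Y' G'
  assume "F \<in> hom (karoubi B) X X'" "F' \<in> hom (karoubi B) X X'"
    "G \<in> hom (karoubi B) Y Y'" "G' \<in> hom (karoubi B) Y Y'"
    "Le (karoubi B) F F'" "Le (karoubi B) G G'"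
  then show "Le (karoubi B) (kar_tensor_arr F G) (kar_tensor_arr F' G')"
    by (cases X; cases X'; cases Y; cases Y') (auto elim!: kar_homE simp: arr_tensor_mono)
next
  show "kar_unit \<in> Obj (karoubi B)"
    by (simp add: kar_unit_def kar_unit_obj)
next
  fix X
  assume "X \<in> Obj (karoubi B)"
  moreover obtain A a where [simp]: "X = (A, a)"
    by (cases X)
  ultimately have X: "(A, a) \<in> kar_obj B"
    by simp
  note a = kar_objD[OF X]
  show "is_iso (karoubi B) X (kar_tensor_obj X kar_unit) (kar_runit X)"
    using kar_iso[OF runit_iso X kar_tensor_obj_closed[OF X kar_unit_obj]] arr_natural(1)[of a a a] a
    by (simp add: kar_unit_def)
  show "is_iso (karoubi B) X (kar_tensor_obj kar_unit X) (kar_lunit X)"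
    using kar_iso[OF lunit_iso X kar_tensor_obj_closed[OF kar_unit_obj X]] arr_natural(2)[of a a a] a
    by (simp add: kar_unit_def)
next
  fix F X Y
  assume F: "F \<in> hom (karoubi B) X Y"
  obtain A a C c where [simp]: "X = (A, a)" "Y = (C, c)"
    by (cases X; cases Y)
  from F obtain R where [simp]: "F = ((A, a), R, (C, c))" "R \<in> Arr B" "Dom B R = A" "Cod B R = C"
      "c \<cdot> R = R" "R \<cdot> a = R" and A: "(A, a) \<in> kar_obj B" and C: "(C, c) \<in> kar_obj B"
    by (auto elim: kar_homE)
  note [simp] = kar_objD[OF A] kar_objD[OF C]
  note natural = arr_natural(1,2)[of R R R, simplified]
  \<comment> \<open>Both sides reduce to \<open>\<rho> C \<cdot> R\<close>: on the left
    \<open>R\<close> absorbs \<open>c\<close>, and on the right it absorbs \<open>a\<close> after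
    the naturality square at \<open>R\<close> has been extended by \<open>a\<close>.\<close>
  show "Comp (karoubi B) (kar_runit Y) F
      = Comp (karoubi B) (kar_tensor_arr F (Ident (karoubi B) kar_unit)) (kar_runit X)"
    using comp_eq_extend[OF natural(1), of a] by (simp add: kar_unit_def)
  show "Comp (karoubi B) (kar_lunit Y) F
      = Comp (karoubi B) (kar_tensor_arr (Ident (karoubi B) kar_unit) F) (kar_lunit X)"
    using comp_eq_extend[OF natural(2), of a] by (simp add: kar_unit_def)
next
  fix X Y
  assume "X \<in> Obj (karoubi B)" "Y \<in> Obj (karoubi B)"
  moreover obtain A a C c where [simp]: "X = (A, a)" "Y = (C, c)"
    by (cases X; cases Y)
  ultimately have A: "(A, a) \<in> kar_obj B" and C: "(C, c) \<in> kar_obj B"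
    by simp_all
  note [simp] = kar_objD[OF A] kar_objD[OF C]
  show "is_iso (karoubi B) (kar_tensor_obj X Y) (kar_tensor_obj Y X) (kar_symm X Y)"
    using kar_iso[OF symm_iso kar_tensor_obj_closed[OF A C] kar_tensor_obj_closed[OF C A]]
      arr_natural(3)[of a c a] by simp
  \<comment> \<open>Cancelling the two symmetries leaves the collected idempotent
    \<open>a \<otimes> c\<close>, which is the identity of the lifted tensor object.\<close>
  have "(\<gamma> C A \<cdot> (c \<otimes> a)) \<cdot> (\<gamma> A C \<cdot> (a \<otimes> c)) = (\<gamma> C A \<cdot> \<gamma> A C) \<cdot> (a \<otimes> c)"
    using arr_natural(3)[of a c a] by (intro comp_lift) (simp_all add: interchange)
  also have "\<dots> = a \<otimes> c"
    by (subst symm_symm) simp_all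
  finally show "Comp (karoubi B) (kar_symm Y X) (kar_symm X Y)
      = Ident (karoubi B) (kar_tensor_obj X Y)"
    by simp
  show "Comp (karoubi B) (kar_assoc X kar_unit Y)
        (kar_tensor_arr (kar_runit X) (Ident (karoubi B) Y))
      = kar_tensor_arr (Ident (karoubi B) X) (kar_lunit Y)"
    using kar_triangle[OF A C] by (simp add: kar_unit_def)
next
  fix F X X' G Y Y'
  assume F: "F \<in> hom (karoubi B) X X'" and G: "G \<in> hom (karoubi B) Y Y'"
  obtain A a A' a' C c C' c' where
    [simp]: "X = (A, a)" "X' = (A', a')" "Y = (C, c)" "Y' = (C', c')"
    by (cases X; cases X'; cases Y; cases Y')
  from F obtain R where [simp]: "F = ((A, a), R, (A', a'))" "R \<in> Arr B" "Dom B R = A" "Cod B R = A'"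
      "a' \<cdot> R = R" "R \<cdot> a = R" and A: "(A, a) \<in> kar_obj B" "(A', a') \<in> kar_obj B"
    by (auto elim: kar_homE)
  from G obtain S where [simp]: "G = ((C, c), S, (C', c'))" "S \<in> Arr B" "Dom B S = C" "Cod B S = C'"
      "c' \<cdot> S = S" "S \<cdot> c = S" and C: "(C, c) \<in> kar_obj B" "(C', c') \<in> kar_obj B"
    by (auto elim: kar_homE)
  note [simp] = A[THEN kar_objD(1)] A[THEN kar_objD(2)] A[THEN kar_objD(3)] A[THEN kar_objD(4)]
    C[THEN kar_objD(1)] C[THEN kar_objD(2)] C[THEN kar_objD(3)] C[THEN kar_objD(4)]
  note natural = arr_natural(3)[of R S R, simplified]
  show "Comp (karoubi B) (kar_symm X' Y') (kar_tensor_arr F G)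
      = Comp (karoubi B) (kar_tensor_arr G F) (kar_symm X Y)"
    using comp_eq_extend[OF natural, of "a \<otimes> c"] by (simp add: interchange)
next
  fix X Y Z
  assume "X \<in> Obj (karoubi B)" "Y \<in> Obj (karoubi B)" "Z \<in> Obj (karoubi B)"
  moreover obtain A a C c E e where [simp]: "X = (A, a)" "Y = (C, c)" "Z = (E, e)"
    by (cases X; cases Y; cases Z)
  ultimately have A: "(A, a) \<in> kar_obj B" and C: "(C, c) \<in> kar_obj B" and E: "(E, e) \<in> kar_obj B"
    by simp_all
  note [simp] = kar_objD[OF A] kar_objD[OF C] kar_objD[OF E]
  show "is_iso (karoubi B) (kar_tensor_obj (kar_tensor_obj X Y) Z)
      (kar_tensor_obj X (kar_tensor_obj Y Z)) (kar_assoc X Y Z)"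
    using kar_iso[OF assoc_iso kar_tensor_obj_closed[OF kar_tensor_obj_closed[OF A C] E]
        kar_tensor_obj_closed[OF A kar_tensor_obj_closed[OF C E]]]
      arr_natural(4)[of a c e] by simp
  \<comment> \<open>Associativity is switched off as a rewrite rule so that the composites keep the
    bracketing of \<open>kar_hexagon\<close>.\<close>
  show "Comp (karoubi B) (kar_assoc Y Z X)
        (Comp (karoubi B) (kar_symm X (kar_tensor_obj Y Z)) (kar_assoc X Y Z))
      = Comp (karoubi B) (kar_tensor_arr (Ident (karoubi B) Y) (kar_symm X Z))
        (Comp (karoubi B) (kar_assoc Y X Z) (kar_tensor_arr (kar_symm X Y) (Ident (karoubi B) Z)))"
    using kar_hexagon[OF A C E] by (simp del: arr_comp_assoc)
next
  fix F X X' G Y Y' H Z Z'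
  assume F: "F \<in> hom (karoubi B) X X'" and G: "G \<in> hom (karoubi B) Y Y'"
    and H: "H \<in> hom (karoubi B) Z Z'"
  obtain A a A' a' C c C' c' E e E' e' where [simp]: "X = (A, a)" "X' = (A', a')"
    "Y = (C, c)" "Y' = (C', c')" "Z = (E, e)" "Z' = (E', e')"
    by (cases X; cases X'; cases Y; cases Y'; cases Z; cases Z')
  from F obtain R where [simp]: "F = ((A, a), R, (A', a'))" "R \<in> Arr B" "Dom B R = A" "Cod B R = A'"
      "a' \<cdot> R = R" "R \<cdot> a = R" and A: "(A, a) \<in> kar_obj B" "(A', a') \<in> kar_obj B"
    by (auto elim: kar_homE)
  from G obtain S where [simp]: "G = ((C, c), S, (C', c'))" "S \<in> Arr B" "Dom B S = C" "Cod B S = C'"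
      "c' \<cdot> S = S" "S \<cdot> c = S" and C: "(C, c) \<in> kar_obj B" "(C', c') \<in> kar_obj B"
    by (auto elim: kar_homE)
  from H obtain T where [simp]: "H = ((E, e), T, (E', e'))" "T \<in> Arr B" "Dom B T = E" "Cod B T = E'"
      "e' \<cdot> T = T" "T \<cdot> e = T" and E: "(E, e) \<in> kar_obj B" "(E', e') \<in> kar_obj B"
    by (auto elim: kar_homE)
  note [simp] = A[THEN kar_objD(1)] A[THEN kar_objD(2)] A[THEN kar_objD(3)] A[THEN kar_objD(4)]
    C[THEN kar_objD(1)] C[THEN kar_objD(2)] C[THEN kar_objD(3)] C[THEN kar_objD(4)]
    E[THEN kar_objD(1)] E[THEN kar_objD(2)] E[THEN kar_objD(3)] E[THEN kar_objD(4)]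
  note natural = arr_natural(4)[of R S T, simplified]
  show "Comp (karoubi B) (kar_assoc X' Y' Z') (kar_tensor_arr (kar_tensor_arr F G) H)
      = Comp (karoubi B) (kar_tensor_arr F (kar_tensor_arr G H)) (kar_assoc X Y Z)"
    using comp_eq_extend[OF natural, of "(a \<otimes> c) \<otimes> e"] by (simp add: interchange)
next
  fix W X Y Z
  assume "W \<in> Obj (karoubi B)" "X \<in> Obj (karoubi B)" "Y \<in> Obj (karoubi B)" "Z \<in> Obj (karoubi B)"
  then show "Comp (karoubi B) (kar_assoc W X (kar_tensor_obj Y Z)) (kar_assoc (kar_tensor_obj W X) Y Z)
      = Comp (karoubi B) (kar_tensor_arr (Ident (karoubi B) W) (kar_assoc X Y Z))
        (Comp (karoubi B) (kar_assoc W (kar_tensor_obj X Y) Z)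
          (kar_tensor_arr (kar_assoc W X Y) (Ident (karoubi B) Z)))"
    by (cases W; cases X; cases Y; cases Z) (simp add: kar_pentagon del: arr_comp_assoc)
qed

end

section \<open>The lifted comonoids\<close>

context cartesian_structure
begin

lemma comonoid_arr [simp]:
  assumes "X \<in> Obj B"
  shows "d X \<in> Arr B" "Dom B (d X) = X" "Cod B (d X) = X \<boxtimes> X"
    "t X \<in> Arr B" "Dom B (t X) = X" "Cod B (t X) = I"
  using comonoid[OF assms] by (auto simp: cocommutative_comonoid_def hom_def)

lemma comonoid_eqs:
  assumes "X \<in> Obj B"
  shows "(\<one> X \<otimes> d X) \<cdot> d X = assoc X X X \<cdot> ((d X \<otimes> \<one> X) \<cdot> d X)"
    "(\<one> X \<otimes> t X) \<cdot> d X = runit X" "(t X \<otimes> \<one> X) \<cdot> d X = lunit X" "symm X X \<cdot> d X = d X"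
  using comonoid[OF assms] by (auto simp: cocommutative_comonoid_def)

lemma arr_comult_lax: "F \<in> Arr B \<Longrightarrow> d (Cod B F) \<cdot> F \<preceq> (F \<otimes> F) \<cdot> d (Dom B F)"
  by (rule comult_lax) (rule hom_self)

lemma arr_counit_lax: "F \<in> Arr B \<Longrightarrow> t (Cod B F) \<cdot> F \<preceq> t (Dom B F)"
  by (rule counit_lax) (rule hom_self)

text \<open>An arrow into \<open>(X \<boxtimes> X, x \<otimes> x)\<close> has to absorb
  \<open>x \<otimes> x\<close>, which \<open>d X \<cdot> x\<close> need not do when \<open>d\<close>
  is only lax natural. The idempotent of the unit object is an identity, so the counit requires no
  such factor.\<close>

definition kar_comult where
  "kar_comult = (\<lambda>(X, x). ((X, x), (x \<otimes> x) \<cdot> (d X \<cdot> x), (X \<boxtimes> X, x \<otimes> x)))"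

definition kar_counit where
  "kar_counit = (\<lambda>(X, x). ((X, x), t X \<cdot> x, (I, \<one> I)))"

lemma kar_comonoid_simps [simp]:
  "kar_comult (X, x) = ((X, x), (x \<otimes> x) \<cdot> (d X \<cdot> x), (X \<boxtimes> X, x \<otimes> x))"
  "kar_counit (X, x) = ((X, x), t X \<cdot> x, (I, \<one> I))"
  by (simp_all add: kar_comult_def kar_counit_def)

context
  fixes X x
  assumes x: "(X, x) \<in> kar_obj B"
begin

lemmas idem [simp] = kar_objD[OF x]

lemma idem_lax:
  shows "d X \<cdot> x \<preceq> (x \<otimes> x) \<cdot> d X" "t X \<cdot> x \<preceq> t X"
  using arr_comult_lax[of x] arr_counit_lax[of x] by simp_all

lemma tensor_idem_comp:
  "\<lbrakk>F \<in> Arr B; Cod B F = X \<boxtimes> X\<rbrakk> \<Longrightarrow> (x \<otimes> x) \<cdot> ((x \<otimes> x) \<cdot> F) = (x \<otimes> x) \<cdot> F"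
  using comp_eq_extend[of "x \<otimes> x" "x \<otimes> x" "x \<otimes> x" F] by (simp add: interchange)

text \<open>Laxity trades the trailing \<open>x\<close> for a second \<open>x \<otimes> x\<close>,
  which merges with the first. This provides the hypothesis \<open>le\<close> of
  \<open>lax_comp_kar_comult\<close> in the proof of coassociativity.\<close>

lemma kar_comult_le: "(x \<otimes> x) \<cdot> (d X \<cdot> x) \<preceq> (x \<otimes> x) \<cdot> d X"
  using comp_mono_right[OF idem_lax(1), of "x \<otimes> x"] by (simp add: tensor_idem_comp)

lemma le_kar_comult: "d X \<cdot> x \<preceq> (x \<otimes> x) \<cdot> (d X \<cdot> x)"
  using comp_mono_left[OF idem_lax(1), of x] by simp

text \<open>This is the squeezing argument common to coassociativity and the counit laws. The upper
  bound drops \<open>x \<otimes> x\<close> behind \<open>m\<close> by \<open>le\<close>; the lower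
  bound creates it from \<open>le_kar_comult\<close>. Afterwards only \<open>d X \<cdot> x\<close>
  remains, to which the comonoid equations of \<open>B\<close> apply.\<close>

lemma lax_comp_kar_comult:
  assumes m: "m \<in> Arr B" "Dom B m = X \<boxtimes> X" and le: "m \<cdot> (x \<otimes> x) \<preceq> m"
  shows "(m \<cdot> (x \<otimes> x)) \<cdot> ((x \<otimes> x) \<cdot> (d X \<cdot> x)) = m \<cdot> (d X \<cdot> x)"
proof (rule arr_antisym)
  have "(m \<cdot> (x \<otimes> x)) \<cdot> (d X \<cdot> x) \<preceq> m \<cdot> (d X \<cdot> x)"
    using m by (intro comp_mono_left le) simp_all
  then show "(m \<cdot> (x \<otimes> x)) \<cdot> ((x \<otimes> x) \<cdot> (d X \<cdot> x)) \<preceq> m \<cdot> (d X \<cdot> x)"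
    using m by (simp add: tensor_idem_comp)
  have "m \<cdot> (d X \<cdot> x) \<preceq> m \<cdot> ((x \<otimes> x) \<cdot> (d X \<cdot> x))"
    using m by (intro comp_mono_right le_kar_comult) simp_all
  then show "m \<cdot> (d X \<cdot> x) \<preceq> (m \<cdot> (x \<otimes> x)) \<cdot> ((x \<otimes> x) \<cdot> (d X \<cdot> x))"
    using m by (simp add: tensor_idem_comp)
qed (use m in simp_all)

lemma kar_coassoc:
  "(x \<otimes> ((x \<otimes> x) \<cdot> (d X \<cdot> x))) \<cdot> ((x \<otimes> x) \<cdot> (d X \<cdot> x))
    = (assoc X X X \<cdot> ((x \<otimes> x) \<otimes> x)) \<cdot> ((((x \<otimes> x) \<cdot> (d X \<cdot> x)) \<otimes> x) \<cdot> ((x \<otimes> x) \<cdot> (d X \<cdot> x)))"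
proof -
  \<comment> \<open>These are the two outer factors with the trailing \<open>x\<close> of the
    comultiplication removed; composing with \<open>x \<otimes> x\<close> restores it.\<close>
  let ?m = "x \<otimes> ((x \<otimes> x) \<cdot> d X)" and ?m' = "((x \<otimes> x) \<cdot> d X) \<otimes> x"
  have m: "?m \<cdot> (x \<otimes> x) = x \<otimes> ((x \<otimes> x) \<cdot> (d X \<cdot> x))"
    and m': "?m' \<cdot> (x \<otimes> x) = ((x \<otimes> x) \<cdot> (d X \<cdot> x)) \<otimes> x"
    by (simp_all add: interchange)
  \<comment> \<open>Unfolding \<open>m\<close> in the remaining inequality turns both of its sides
    into tensors, which are compared factor by factor using \<open>kar_comult_le\<close>.\<close>
  have l: "(x \<otimes> ((x \<otimes> x) \<cdot> (d X \<cdot> x))) \<cdot> ((x \<otimes> x) \<cdot> (d X \<cdot> x)) = ?m \<cdot> (d X \<cdot> x)"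
    unfolding m[symmetric]
    by (rule lax_comp_kar_comult; (unfold m)?)
      (simp_all add: arr_tensor_mono arr_le_refl kar_comult_le)
  have r: "(((x \<otimes> x) \<cdot> (d X \<cdot> x)) \<otimes> x) \<cdot> ((x \<otimes> x) \<cdot> (d X \<cdot> x)) = ?m' \<cdot> (d X \<cdot> x)"
    unfolding m'[symmetric]
    by (rule lax_comp_kar_comult; (unfold m')?)
      (simp_all add: arr_tensor_mono arr_le_refl kar_comult_le)
  have "?m \<cdot> (d X \<cdot> x) = ((x \<otimes> (x \<otimes> x)) \<cdot> (\<one> X \<otimes> d X)) \<cdot> (d X \<cdot> x)"
    by (simp add: interchange)
  also have "\<dots> = (x \<otimes> (x \<otimes> x)) \<cdot> (((\<one> X \<otimes> d X) \<cdot> d X) \<cdot> x)"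
    by simp
  also have "\<dots> = ((x \<otimes> (x \<otimes> x)) \<cdot> assoc X X X) \<cdot> ((d X \<otimes> \<one> X) \<cdot> (d X \<cdot> x))"
    by (simp add: comonoid_eqs)
  also have "\<dots> = assoc X X X \<cdot> ((((x \<otimes> x) \<otimes> x) \<cdot> (d X \<otimes> \<one> X)) \<cdot> (d X \<cdot> x))"
    using arr_natural(4)[of x x x] by simp
  \<comment> \<open>The idempotent is duplicated: one copy belongs to the lifted associator, the
    other to \<open>?m'\<close>.\<close>
  also have "((x \<otimes> x) \<otimes> x) \<cdot> (d X \<otimes> \<one> X) = ((x \<otimes> x) \<otimes> x) \<cdot> ?m'"
    using tensor_idem_comp[of "d X"] by (simp add: interchange)
  finally show ?thesis
    unfolding l r by simp
qed

text \<open>Squeezing applies with \<open>m\<close> equal to \<open>x \<otimes> t X\<close>, because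
  \<open>t X \<cdot> x\<close> lies below \<open>t X\<close>. The counit law of \<open>B\<close> and
  naturality of \<open>runit\<close> then leave a single \<open>x\<close>.\<close>

lemma kar_counit_right: "(x \<otimes> (t X \<cdot> x)) \<cdot> ((x \<otimes> x) \<cdot> (d X \<cdot> x)) = runit X \<cdot> x"
proof -
  have m: "(x \<otimes> t X) \<cdot> (x \<otimes> x) = x \<otimes> (t X \<cdot> x)"
    by (simp add: interchange)
  have "(x \<otimes> (t X \<cdot> x)) \<cdot> ((x \<otimes> x) \<cdot> (d X \<cdot> x)) = (x \<otimes> t X) \<cdot> (d X \<cdot> x)"
    unfolding m[symmetric]
    by (rule lax_comp_kar_comult; (unfold m)?)
      (simp_all add: arr_tensor_mono arr_le_refl idem_lax)
  also have "\<dots> = ((x \<otimes> \<one> I) \<cdot> (\<one> X \<otimes> t X)) \<cdot> (d X \<cdot> x)"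
    by (simp add: interchange)
  also have "\<dots> = (x \<otimes> \<one> I) \<cdot> (((\<one> X \<otimes> t X) \<cdot> d X) \<cdot> x)"
    by simp
  also have "\<dots> = ((x \<otimes> \<one> I) \<cdot> runit X) \<cdot> x"
    by (simp add: comonoid_eqs)
  also have "\<dots> = runit X \<cdot> x"
    using arr_natural(1)[of x x x] by simp
  finally show ?thesis .
qed

lemma kar_counit_left: "((t X \<cdot> x) \<otimes> x) \<cdot> ((x \<otimes> x) \<cdot> (d X \<cdot> x)) = lunit X \<cdot> x"
proof -
  have m: "(t X \<otimes> x) \<cdot> (x \<otimes> x) = (t X \<cdot> x) \<otimes> x"
    by (simp add: interchange)
  have "((t X \<cdot> x) \<otimes> x) \<cdot> ((x \<otimes> x) \<cdot> (d X \<cdot> x)) = (t X \<otimes> x) \<cdot> (d X \<cdot> x)"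
    unfolding m[symmetric]
    by (rule lax_comp_kar_comult; (unfold m)?)
      (simp_all add: arr_tensor_mono arr_le_refl idem_lax)
  also have "\<dots> = ((\<one> I \<otimes> x) \<cdot> (t X \<otimes> \<one> X)) \<cdot> (d X \<cdot> x)"
    by (simp add: interchange)
  also have "\<dots> = (\<one> I \<otimes> x) \<cdot> (((t X \<otimes> \<one> X) \<cdot> d X) \<cdot> x)"
    by simp
  also have "\<dots> = ((\<one> I \<otimes> x) \<cdot> lunit X) \<cdot> x"
    by (simp add: comonoid_eqs)
  also have "\<dots> = lunit X \<cdot> x"
    using arr_natural(2)[of x x x] by simp
  finally show ?thesis .
qed

text \<open>No squeezing is involved: \<open>x \<otimes> x\<close> crosses the symmetry unchanged
  because its two factors agree, and \<open>d X\<close> absorbs the symmetry.\<close>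

lemma kar_cocommutative:
  "(symm X X \<cdot> (x \<otimes> x)) \<cdot> ((x \<otimes> x) \<cdot> (d X \<cdot> x)) = (x \<otimes> x) \<cdot> (d X \<cdot> x)"
proof -
  have "(symm X X \<cdot> (x \<otimes> x)) \<cdot> ((x \<otimes> x) \<cdot> (d X \<cdot> x)) = (symm X X \<cdot> (x \<otimes> x)) \<cdot> (d X \<cdot> x)"
    by (simp add: tensor_idem_comp)
  also have "\<dots> = ((x \<otimes> x) \<cdot> symm X X) \<cdot> (d X \<cdot> x)"
    using arr_natural(3)[of x x x] by (simp del: arr_comp_assoc)
  also have "((x \<otimes> x) \<cdot> symm X X) \<cdot> (d X \<cdot> x) = (x \<otimes> x) \<cdot> ((symm X X \<cdot> d X) \<cdot> x)"
    by simp
  finally show ?thesis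
    by (simp add: comonoid_eqs)
qed

end

section \<open>The Cartesian structure on the Karoubi bicategory\<close>

lemma kar_cocommutative_comonoid:
  assumes "X \<in> kar_obj B"
  shows "tensor_product.cocommutative_comonoid (karoubi B) kar_tensor_obj kar_tensor_arr kar_unit
    kar_runit kar_lunit kar_symm kar_assoc X (kar_comult X) (kar_counit X)"
proof -
  obtain A a where [simp]: "X = (A, a)"
    by (cases X)
  with assms have a: "(A, a) \<in> kar_obj B"
    by simp
  note [simp] = kar_objD[OF a]
  have "kar_comult X \<in> hom (karoubi B) X (kar_tensor_obj X X)"
    using kar_homI[OF a kar_tensor_obj_closed[OF a a], of "(a \<otimes> a) \<cdot> (d A \<cdot> a)"]
    by (simp add: tensor_idem_comp[OF a])
  moreover have "kar_counit X \<in> hom (karoubi B) X kar_unit"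
    using kar_homI[OF a kar_unit_obj, of "t A \<cdot> a"] by (simp add: kar_unit_def)
  ultimately show ?thesis
    unfolding tensor_product.cocommutative_comonoid_def[OF tensor_product_karoubi]
    using kar_coassoc[OF a] kar_counit_right[OF a] kar_counit_left[OF a] kar_cocommutative[OF a]
    by (simp add: kar_unit_def del: arr_comp_assoc)
qed

lemma cartesian_structure_karoubi:
  "cartesian_structure (karoubi B) kar_tensor_obj kar_tensor_arr kar_unit kar_runit kar_lunit
    kar_symm kar_assoc kar_comult kar_counit"
proof (intro cartesian_structure.intro tensor_product_karoubi cartesian_structure_axioms.intro)
  fix X
  assume X: "X \<in> Obj (karoubi B)"
  then show "tensor_product.cocommutative_comonoid (karoubi B) kar_tensor_obj kar_tensor_arr
      kar_unit kar_runit kar_lunit kar_symm kar_assoc X (kar_comult X) (kar_counit X)"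
    by (intro kar_cocommutative_comonoid) simp
  obtain A a where [simp]: "X = (A, a)"
    by (cases X)
  with X have a: "(A, a) \<in> kar_obj B"
    by simp
  note [simp] = kar_objD[OF a]
  show "has_right_adjoint (karoubi B) X (kar_tensor_obj X X) (kar_comult X)"
    using kar_adjoint[OF comult_adjoint a kar_tensor_obj_closed[OF a a] idem_lax(1)[OF a]] by simp
  show "has_right_adjoint (karoubi B) X kar_unit (kar_counit X)"
    using kar_adjoint[OF counit_adjoint a kar_unit_obj] idem_lax(2)[OF a] by (simp add: kar_unit_def)
next
  fix F X Y
  assume F: "F \<in> hom (karoubi B) X Y"
  obtain A a C c where [simp]: "X = (A, a)" "Y = (C, c)"
    by (cases X; cases Y)
  from F obtain R where [simp]: "F = ((A, a), R, (C, c))" "R \<in> Arr B" "Dom B R = A" "Cod B R = C"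
      "c \<cdot> R = R" "R \<cdot> a = R" and A: "(A, a) \<in> kar_obj B" and C: "(C, c) \<in> kar_obj B"
    by (auto elim: kar_homE)
  note [simp] = kar_objD(1-4)[OF A] kar_objD(1-4)[OF C]
  \<comment> \<open>The laxity of \<open>d\<close> at \<open>R\<close> is placed between the
    idempotents. The next two equations show that \<open>R \<otimes> R\<close> absorbs the outer
    \<open>c \<otimes> c\<close> as well as the \<open>a \<otimes> a\<close> coming from the lifted
    comultiplication.\<close>
  have "(c \<otimes> c) \<cdot> ((d C \<cdot> R) \<cdot> a) \<preceq> (c \<otimes> c) \<cdot> (((R \<otimes> R) \<cdot> d A) \<cdot> a)"
    using arr_comult_lax[of R] by (intro comp_mono_right comp_mono_left) simp_all
  moreover have "(c \<otimes> c) \<cdot> ((R \<otimes> R) \<cdot> (d A \<cdot> a)) = (R \<otimes> R) \<cdot> (d A \<cdot> a)"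
    using comp_eq_extend[of "c \<otimes> c" "R \<otimes> R" "R \<otimes> R" "d A \<cdot> a"] by (simp add: interchange)
  moreover have "(R \<otimes> R) \<cdot> ((a \<otimes> a) \<cdot> (d A \<cdot> a)) = (R \<otimes> R) \<cdot> (d A \<cdot> a)"
    using comp_eq_extend[of "R \<otimes> R" "a \<otimes> a" "R \<otimes> R" "d A \<cdot> a"] by (simp add: interchange)
  ultimately show "Le (karoubi B) (Comp (karoubi B) (kar_comult Y) F)
      (Comp (karoubi B) (kar_tensor_arr F F) (kar_comult X))"
    by simp
  have "(t C \<cdot> R) \<cdot> a \<preceq> t A \<cdot> a"
    using arr_counit_lax[of R] by (intro comp_mono_left) simp_all
  then show "Le (karoubi B) (Comp (karoubi B) (kar_counit Y) F) (kar_counit X)"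
    by (simp add: kar_unit_def)
qed

end

theorem theorem2p2p15:
  fixes B :: "('o, 'm) bicat"
  assumes "locally_ordered_bicategory B" and "cartesian B"
  shows "locally_ordered_bicategory (karoubi B) \<and> cartesian (karoubi B)"
proof
  show "locally_ordered_bicategory (karoubi B)"
    using assms(1) by (rule locally_ordered_bicategory.locally_ordered_bicategory_karoubi)
  show "cartesian (karoubi B)"
    using assms(2) cartesian_structure.cartesian_structure_karoubi
    unfolding cartesian_def by fast
qed

end
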